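(* Let $(X,\mathcal{B})$ be a bornological universe where $X$ is a Tychonoff space. Then $(X,\mathcal{B})$ is realcompact if and only if the uniform space $(X,\mathcal{C}_{\mathcal{B}}(X))$ is complete.
   Context: A bornology on a set $X$ is a set $\mathcal{B}\subseteq 2^X$ such that $\{x\}\in\mathcal{B}$ for each $x\in X$; $B\in\mathcal{B}$ and $A\subseteq B$ imply $A\in\mathcal{B}$; and $A\cup B\in\mathcal{B}$ whenever $A,B\in\mathcal{B}$. A bornological universe $(X,\mathcal{B})$ is a topological space $X$ endowed with a bornology $\mathcal{B}$ on its underlying set. Tychonoff means completely regular and Hausdorff. $\mathcal{C}_{\mathcal{B}}(X)$ is the set of all continuous real valued maps on $X$ that are bounded on every element of $\mathcal{B}$. For a set $\mathcal{C}$ of real valued maps on a set $X$, $(X,\mathcal{C})$ denotes $X$ with the initial uniformity for the maps in $\mathcal{C}$, i.e. the uniformity generated (as a subbase) by the sets $U_f^{\epsilon}=\{(x,y)\in X\times X: |f(x)-f(y)|<\epsilon\}$ with $f\in\mathcal{C}$, $\epsilon>0$. For $X$ Tychonoff and a continuous $f:X\to\mathbb{R}$, $f^{\beta}$ denotes the unique continuous map from the Stone–Čech compactification $\beta(X)$ to the one-point compactification $\mathbb{R}\cup\{\infty\}$ whose restriction to $X$ is $f$. Put $\upsilon_{\mathcal{B}}(X)=\{x\in\beta(X)\mid \forall f\in\mathcal{C}_{\mathcal{B}}(X): f^{\beta}(x)\neq\infty\}$, a subspace of $\beta(X)$ containing $X$. $(X,\mathcal{B})$ is realcompact if $\upsilon_{\mathcal{B}}(X)=X$.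 *)

theory Defs
  imports "HOL-Analysis.Analysis"
begin

section \<open>Bornological universes\<close>

definition bornology_on :: "'a set \<Rightarrow> 'a set set \<Rightarrow> bool" where
  "bornology_on S \<B> \<longleftrightarrow>
     \<B> \<subseteq> Pow S \<and>
     (\<forall>x\<in>S. {x} \<in> \<B>) \<and>
     (\<forall>A B. B \<in> \<B> \<longrightarrow> A \<subseteq> B \<longrightarrow> A \<in> \<B>) \<and>
     (\<forall>A B. A \<in> \<B> \<longrightarrow> B \<in> \<B> \<longrightarrow> A \<union> B \<in> \<B>)"

definition bornological_universe :: "'a topology \<Rightarrow> 'a set set \<Rightarrow> bool" where
  "bornological_universe X \<B> \<longleftrightarrow> bornology_on (topspace X) \<B>"

definition Tychonoff_space :: "'a topology \<Rightarrow> bool" where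
  "Tychonoff_space X \<longleftrightarrow> completely_regular_space X \<and> Hausdorff_space X"

definition bounded_continuous_maps :: "'a topology \<Rightarrow> 'a set set \<Rightarrow> ('a \<Rightarrow> real) set" where
  "bounded_continuous_maps X \<B> =
     {f. continuous_map X euclideanreal f \<and> (\<forall>B\<in>\<B>. bounded (f ` B))}"

section \<open>Uniformities on a carrier set\<close>

text \<open>
  The library's uniform spaces are a type class, so the uniformity is tied to the type.  Here a
  uniformity on a set \<open>S\<close> is a filter on \<open>S \<times> S\<close>, encoded as a filter on the type that lies
  below the principal filter of \<open>S \<times> S\<close>.
\<close>

definition uniformity_on_set :: "'a set \<Rightarrow> ('a \<times> 'a) filter \<Rightarrow> bool" where
  "uniformity_on_set S U \<longleftrightarrow>
     U \<le> principal (S \<times> S) \<and>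
     (\<forall>E. eventually E U \<longrightarrow> (\<forall>x\<in>S. E (x, x))) \<and>
     (\<forall>E. eventually E U \<longrightarrow> eventually (\<lambda>(x, y). E (y, x)) U) \<and>
     (\<forall>E. eventually E U \<longrightarrow>
        (\<exists>D. eventually D U \<and> (\<forall>x y z. D (x, y) \<longrightarrow> D (y, z) \<longrightarrow> E (x, z))))"

definition initial_uniformity :: "'a set \<Rightarrow> ('a \<Rightarrow> real) set \<Rightarrow> ('a \<times> 'a) filter" where
  "initial_uniformity S C =
     inf (principal (S \<times> S))
         (INF f\<in>C. INF \<epsilon>\<in>{0<..}. principal {(x, y) \<in> S \<times> S. \<bar>f x - f y\<bar> < \<epsilon>})"

text \<open>The neighbourhood filter of a point in the topology induced by a uniformity.\<close>

definition uniform_nhds :: "('a \<times> 'a) filter \<Rightarrow> 'a \<Rightarrow> 'a filter" where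
  "uniform_nhds U x = filtermap snd (inf U (principal ({x} \<times> UNIV)))"

definition complete_uniform_space :: "'a set \<Rightarrow> ('a \<times> 'a) filter \<Rightarrow> bool" where
  "complete_uniform_space S U \<longleftrightarrow>
     (\<forall>F \<le> principal S. F \<noteq> bot \<longrightarrow> F \<times>\<^sub>F F \<le> U \<longrightarrow> (\<exists>x\<in>S. F \<le> uniform_nhds U x))"

lemma eventually_uniform_nhds:
  "eventually P (uniform_nhds U x) \<longleftrightarrow> eventually (\<lambda>(x', y). x' = x \<longrightarrow> P y) U"
  by (auto simp: uniform_nhds_def eventually_filtermap eventually_inf_principal
      intro!: arg_cong[where f = "\<lambda>P. eventually P U"])

lemma uniform_nhds_uniformity [simp]: "uniform_nhds uniformity x = nhds x"
  for x :: "'a::uniform_space"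
  by (simp add: filter_eq_iff eventually_uniform_nhds eventually_nhds_uniformity)

lemma complete_uniform_space_uniformity:
  "complete_uniform_space (UNIV :: 'a::uniform_space set) uniformity \<longleftrightarrow> complete (UNIV :: 'a set)"
  by (simp add: complete_uniform_space_def complete_uniform cauchy_filter_def)

lemma eventually_initial_uniformity:
  "eventually E (initial_uniformity S C) \<longleftrightarrow>
     (\<exists>F \<epsilon>. finite F \<and> F \<subseteq> C \<and> \<epsilon> > 0 \<and>
        (\<forall>x\<in>S. \<forall>y\<in>S. (\<forall>f\<in>F. \<bar>f x - f y\<bar> < \<epsilon>) \<longrightarrow> E (x, y)))"
proof -
  define b where "b p = {(x, y) \<in> S \<times> S. \<forall>f\<in>fst p. \<bar>f x - f y\<bar> < snd p}"
    for p :: "('a \<Rightarrow> real) set \<times> real"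
  define I where "I = {F. finite F \<and> F \<subseteq> C} \<times> {0::real<..}"
  have "initial_uniformity S C = (INF p\<in>I. principal (b p))" (is "?L = ?R")
  proof (rule antisym)
    show "?L \<le> ?R"
    proof (rule INF_greatest)
      fix p assume "p \<in> I"
      then obtain F \<epsilon> where p: "p = (F, \<epsilon>)" "finite F" "F \<subseteq> C" "\<epsilon> > 0"
        by (auto simp: I_def)
      have "eventually (\<lambda>(x, y). \<bar>f x - f y\<bar> < \<epsilon>) ?L" if "f \<in> F" for f
      proof -
        have "?L \<le> principal {(x, y) \<in> S \<times> S. \<bar>f x - f y\<bar> < \<epsilon>}"
          unfolding initial_uniformity_def using that p
          by (intro le_infI2 INF_lower2[of f] INF_lower2[of \<epsilon>]) auto
        then have "eventually (\<lambda>z. z \<in> {(x, y) \<in> S \<times> S. \<bar>f x - f y\<bar> < \<epsilon>}) ?L"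
          by (simp add: le_principal)
        then show ?thesis
          by (rule eventually_mono) auto
      qed
      then have "eventually (\<lambda>z. \<forall>f\<in>F. case z of (x, y) \<Rightarrow> \<bar>f x - f y\<bar> < \<epsilon>) ?L"
        using p by (intro eventually_ball_finite) auto
      moreover have "eventually (\<lambda>z. z \<in> S \<times> S) ?L"
        by (simp add: initial_uniformity_def flip: le_principal)
      ultimately have "eventually (\<lambda>z. z \<in> b p) ?L"
        by eventually_elim (auto simp: b_def p)
      then show "?L \<le> principal (b p)"
        by (simp add: le_principal)
    qed
    show "?R \<le> ?L"
      unfolding initial_uniformity_def
    proof (intro le_infI INF_greatest)
      show "?R \<le> principal (S \<times> S)"
        by (rule INF_lower2[of "({}, 1)"]) (auto simp: I_def b_def)
    next
      fix f \<epsilon> assume "f \<in> C" "\<epsilon> \<in> {0::real<..}"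
      then show "?R \<le> principal {(x, y) \<in> S \<times> S. \<bar>f x - f y\<bar> < \<epsilon>}"
        by (intro INF_lower2[of "({f}, \<epsilon>)"]) (auto simp: I_def b_def)
    qed
  qed
  also have "eventually E \<dots> \<longleftrightarrow> (\<exists>p\<in>I. eventually E (principal (b p)))"
  proof (rule eventually_INF_base)
    show "I \<noteq> {}"
      by (auto simp: I_def intro!: exI[of _ "{}"] exI[of _ 1])
  next
    fix p q assume "p \<in> I" "q \<in> I"
    then show "\<exists>r\<in>I. principal (b r) \<le> inf (principal (b p)) (principal (b q))"
      by (intro bexI[of _ "(fst p \<union> fst q, min (snd p) (snd q))"]) (auto simp: I_def b_def)
  qed
  finally have "eventually E (initial_uniformity S C) \<longleftrightarrow>
      (\<exists>F \<epsilon>. (F, \<epsilon>) \<in> I \<and> (\<forall>z\<in>b (F, \<epsilon>). E z))"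
    by (simp add: eventually_principal Bex_def split_paired_Ex)
  moreover have "(\<forall>z\<in>b (F, \<epsilon>). E z) \<longleftrightarrow>
      (\<forall>x\<in>S. \<forall>y\<in>S. (\<forall>f\<in>F. \<bar>f x - f y\<bar> < \<epsilon>) \<longrightarrow> E (x, y))" for F \<epsilon>
    unfolding b_def by auto
  ultimately show ?thesis
    by (simp add: I_def conj_assoc)
qed

lemma uniformity_on_set_initial: "uniformity_on_set S (initial_uniformity S C)"
  unfolding uniformity_on_set_def
proof (intro conjI allI impI)
  show "initial_uniformity S C \<le> principal (S \<times> S)"
    by (simp add: initial_uniformity_def)
next
  fix E assume "eventually E (initial_uniformity S C)"
  then obtain F \<epsilon> where F: "finite F" "F \<subseteq> C" "\<epsilon> > 0"
    and E: "\<And>x y. x \<in> S \<Longrightarrow> y \<in> S \<Longrightarrow> (\<forall>f\<in>F. \<bar>f x - f y\<bar> < \<epsilon>) \<Longrightarrow> E (x, y)"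
    by (auto simp: eventually_initial_uniformity)
  show "\<forall>x\<in>S. E (x, x)"
    using F E by auto
  show "eventually (\<lambda>(x, y). E (y, x)) (initial_uniformity S C)"
    unfolding eventually_initial_uniformity using F E
    by (intro exI[of _ F] exI[of _ \<epsilon>]) (auto simp: abs_minus_commute)
  show "\<exists>D. eventually D (initial_uniformity S C) \<and>
          (\<forall>x y z. D (x, y) \<longrightarrow> D (y, z) \<longrightarrow> E (x, z))"
  proof (intro exI[of _ "\<lambda>(x, y). x \<in> S \<and> y \<in> S \<and> (\<forall>f\<in>F. \<bar>f x - f y\<bar> < \<epsilon> / 2)"] conjI allI impI)
    show "eventually (\<lambda>(x, y). x \<in> S \<and> y \<in> S \<and> (\<forall>f\<in>F. \<bar>f x - f y\<bar> < \<epsilon> / 2))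
            (initial_uniformity S C)"
      unfolding eventually_initial_uniformity using F
      by (intro exI[of _ F] exI[of _ "\<epsilon> / 2"]) auto
  next
    fix x y z
    assume xy: "case (x, y) of (x, y) \<Rightarrow> x \<in> S \<and> y \<in> S \<and> (\<forall>f\<in>F. \<bar>f x - f y\<bar> < \<epsilon> / 2)"
      and yz: "case (y, z) of (x, y) \<Rightarrow> x \<in> S \<and> y \<in> S \<and> (\<forall>f\<in>F. \<bar>f x - f y\<bar> < \<epsilon> / 2)"
    have "\<bar>f x - f z\<bar> < \<epsilon>" if "f \<in> F" for f
    proof -
      have "\<bar>f x - f y\<bar> < \<epsilon> / 2" "\<bar>f y - f z\<bar> < \<epsilon> / 2"
        using xy yz that by auto
      then show ?thesis by linarith
    qed
    then show "E (x, z)"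
      using xy yz E by auto
  qed
qed

section \<open>The Stone--Cech compactification\<close>

text \<open>
  The closure of the image of \<open>X\<close> under the canonical map into the cube indexed by the
  continuous maps from \<open>X\<close> to the unit interval.  The index functions are made extensional, so
  that maps agreeing on \<open>topspace X\<close> give the same coordinate.
\<close>

definition cube_index :: "'a topology \<Rightarrow> ('a \<Rightarrow> real) set" where
  "cube_index X = {f \<in> extensional (topspace X). continuous_map X (top_of_set {0..1}) f}"

definition cube :: "'a topology \<Rightarrow> (('a \<Rightarrow> real) \<Rightarrow> real) topology" where
  "cube X = product_topology (\<lambda>f. top_of_set {0..1}) (cube_index X)"

definition stone_cech_embedding :: "'a topology \<Rightarrow> 'a \<Rightarrow> (('a \<Rightarrow> real) \<Rightarrow> real)" where
  "stone_cech_embedding X x = (\<lambda>f\<in>cube_index X. f x)"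

definition stone_cech :: "'a topology \<Rightarrow> (('a \<Rightarrow> real) \<Rightarrow> real) topology" where
  "stone_cech X =
     subtopology (cube X) (cube X closure_of (stone_cech_embedding X ` topspace X))"

lemma stone_cech_embedding_in_cube:
  "x \<in> topspace X \<Longrightarrow> stone_cech_embedding X x \<in> topspace (cube X)"
  by (auto simp: cube_def stone_cech_embedding_def cube_index_def continuous_map_in_subtopology)

lemma topspace_stone_cech:
  "topspace (stone_cech X) = cube X closure_of (stone_cech_embedding X ` topspace X)"
  by (simp add: stone_cech_def closure_of_subset_topspace inf_absorb2)

lemma stone_cech_embedding_in_stone_cech:
  assumes "x \<in> topspace X"
  shows "stone_cech_embedding X x \<in> topspace (stone_cech X)"
proof -
  have "stone_cech_embedding X ` topspace X \<subseteq> topspace (cube X)"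
    by (auto simp: stone_cech_embedding_in_cube)
  then show ?thesis
    using closure_of_subset assms unfolding topspace_stone_cech by fastforce
qed

lemma compact_space_stone_cech: "compact_space (stone_cech X)"
proof -
  have "compact_space (cube X)"
    by (auto simp: cube_def compact_space_product_topology compact_space_subtopology)
  then show ?thesis
    by (simp add: stone_cech_def closedin_compact_space compact_space_subtopology)
qed

lemma Hausdorff_space_stone_cech: "Hausdorff_space (stone_cech X)"
  by (auto simp: stone_cech_def cube_def Hausdorff_space_product_topology
      intro!: Hausdorff_space_subtopology)

lemma dense_stone_cech_embedding:
  "stone_cech X closure_of (stone_cech_embedding X ` topspace X) = topspace (stone_cech X)"
proof -
  have "stone_cech_embedding X ` topspace X \<subseteq> topspace (stone_cech X)"
    by (auto simp: stone_cech_embedding_in_stone_cech)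
  then show ?thesis
    by (simp add: topspace_stone_cech stone_cech_def closure_of_subtopology inf_absorb2
        closure_of_subset_topspace)
qed

lemma embedding_map_stone_cech_embedding:
  assumes "Tychonoff_space X"
  shows "embedding_map X (stone_cech X) (stone_cech_embedding X)"
proof -
  have "mspace (submetric (cfunspace X euclidean_metric) {f. f \<in> topspace X \<rightarrow> {0..1::real}})
          = cube_index X"
    by (auto simp: cube_index_def continuous_map_in_subtopology Pi_iff
        intro!: bounded_subset[OF bounded_closed_interval[of "0::real" 1]])
  then have "embedding_map X (cube X) (stone_cech_embedding X)"
    using completely_regular_space_cube_embedding_explicit[of X] assms
    by (simp add: Tychonoff_space_def cube_def stone_cech_embedding_def[abs_def])
  then show ?thesis
    unfolding stone_cech_def
    by (subst embedding_map_in_subtopology)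
       (auto intro!: closure_of_subset simp: stone_cech_embedding_in_cube)
qed

text \<open>
  In the one-point compactification of the reals, \<open>None\<close> is the point at infinity.  The
  extension is made extensional so that it is determined as a HOL function.
\<close>

definition is_stone_cech_extension ::
    "'a topology \<Rightarrow> ('a \<Rightarrow> real) \<Rightarrow> ((('a \<Rightarrow> real) \<Rightarrow> real) \<Rightarrow> real option) \<Rightarrow> bool" where
  "is_stone_cech_extension X f g \<longleftrightarrow>
     g \<in> extensional (topspace (stone_cech X)) \<and>
     continuous_map (stone_cech X) (Alexandroff_compactification euclideanreal) g \<and>
     (\<forall>x\<in>topspace X. g (stone_cech_embedding X x) = Some (f x))"

definition stone_cech_extension ::
    "'a topology \<Rightarrow> ('a \<Rightarrow> real) \<Rightarrow> (('a \<Rightarrow> real) \<Rightarrow> real) \<Rightarrow> real option" where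
  "stone_cech_extension X f = (THE g. is_stone_cech_extension X f g)"

lemma stone_cech_extension_exists:
  assumes K: "compact_space K" "Tychonoff_space K" and f: "continuous_map X K f"
  obtains g where "continuous_map (stone_cech X) K g"
    and "\<And>x. x \<in> topspace X \<Longrightarrow> g (stone_cech_embedding X x) = f x"
proof -
  let ?e = "stone_cech_embedding K" and ?Z = "stone_cech_embedding K ` topspace K"
  define \<phi> where "\<phi> y = (\<lambda>h\<in>cube_index K. y (restrict (h \<circ> f) (topspace X)))"
    for y :: "_ \<Rightarrow> real"
  have idx: "restrict (h \<circ> f) (topspace X) \<in> cube_index X" if "h \<in> cube_index K" for h
  proof -
    have "continuous_map X (top_of_set {0..1}) (h \<circ> f)"
      using that f by (auto simp: cube_index_def intro: continuous_map_compose)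
    then have "continuous_map X (top_of_set {0..1}) (restrict (h \<circ> f) (topspace X))"
      by (rule continuous_map_eq) auto
    then show ?thesis by (simp add: cube_index_def)
  qed
  have "continuous_map (cube X) (cube K) \<phi>"
    unfolding cube_def continuous_map_componentwise
  proof (intro conjI ballI)
    show "\<phi> ` topspace (product_topology (\<lambda>f. top_of_set {0..1}) (cube_index X))
            \<subseteq> extensional (cube_index K)"
      by (auto simp: \<phi>_def)
  next
    fix h assume h: "h \<in> cube_index K"
    then have "(\<lambda>y. \<phi> y h) = (\<lambda>y. y (restrict (h \<circ> f) (topspace X)))"
      by (simp add: \<phi>_def)
    then show "continuous_map (product_topology (\<lambda>f. top_of_set {0..1}) (cube_index X))
                 (top_of_set {0..1}) (\<lambda>y. \<phi> y h)"
      using continuous_map_product_projection[OF idx[OF h], of "\<lambda>f. top_of_set {0..1::real}"]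
      by simp
  qed
  then have \<phi>: "continuous_map (stone_cech X) (cube K) \<phi>"
    by (simp add: stone_cech_def continuous_map_from_subtopology)
  have \<phi>e: "\<phi> (stone_cech_embedding X x) = ?e (f x)" if "x \<in> topspace X" for x
    using that by (auto simp: \<phi>_def stone_cech_embedding_def idx)
  have fX: "f ` topspace X \<subseteq> topspace K"
    using f by (simp add: continuous_map_image_subset_topspace)
  have emb: "embedding_map K (stone_cech K) ?e"
    by (rule embedding_map_stone_cech_embedding[OF K(2)])
  then have emb: "embedding_map K (cube K) ?e"
    by (simp add: stone_cech_def embedding_map_in_subtopology)
  have "compactin (cube K) ?Z"
  proof (rule image_compactin)
    show "compactin K (topspace K)"
      using K(1) by (simp add: compact_space_def)
    show "continuous_map K (cube K) ?e"
      using emb by (simp add: embedding_map_def homeomorphic_imp_continuous_map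
          continuous_map_into_fulltopology[OF homeomorphic_imp_continuous_map])
  qed
  moreover have "Hausdorff_space (cube K)"
    by (auto simp: cube_def Hausdorff_space_product_topology intro!: Hausdorff_space_subtopology)
  ultimately have "closedin (cube K) ?Z"
    by (rule compactin_imp_closedin[rotated])
  have "\<phi> ` topspace (stone_cech X) \<subseteq> cube K closure_of (\<phi> ` stone_cech_embedding X ` topspace X)"
    using continuous_map_image_closure_subset[OF \<phi>] by (metis dense_stone_cech_embedding)
  also have "\<dots> \<subseteq> ?Z"
    by (rule closure_of_minimal) (use fX \<phi>e \<open>closedin (cube K) ?Z\<close> in auto)
  finally have \<phi>': "continuous_map (stone_cech X) (subtopology (cube K) ?Z) \<phi>"
    using \<phi> by (auto simp: continuous_map_in_subtopology)
  obtain r where "homeomorphic_maps K (subtopology (cube K) ?Z) ?e r"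
    using emb by (auto simp: embedding_map_def homeomorphic_map_maps)
  then have r: "continuous_map (subtopology (cube K) ?Z) K r"
    and re: "\<And>z. z \<in> topspace K \<Longrightarrow> r (?e z) = z"
    by (auto simp: homeomorphic_maps_def)
  show thesis
  proof
    show "continuous_map (stone_cech X) K (r \<circ> \<phi>)"
      using \<phi>' r by (rule continuous_map_compose)
    show "(r \<circ> \<phi>) (stone_cech_embedding X x) = f x" if "x \<in> topspace X" for x
      using that fX by (auto simp: \<phi>e re)
  qed
qed

lemma ex1_stone_cech_extension:
  assumes f: "continuous_map X euclideanreal f"
  shows "\<exists>!g. is_stone_cech_extension X f g"
proof -
  let ?K = "Alexandroff_compactification euclideanreal" and ?e = "stone_cech_embedding X"
  have lc: "locally_compact_space euclideanreal"
    by (simp add: locally_compact_space_euclidean)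
  have HK: "Hausdorff_space ?K"
    by (simp add: Hausdorff_space_Alexandroff_compactification lc)
  have "completely_regular_space euclideanreal"
    by (simp add: metrizable_imp_completely_regular_space metrizable_space_euclidean)
  then have TK: "Tychonoff_space ?K"
    using HK by (simp add: Tychonoff_space_def completely_regular_space_Alexandroff_compactification lc)
  have "continuous_map X ?K (Some \<circ> f)"
    using f continuous_map_Some by (rule continuous_map_compose)
  then obtain g where g: "continuous_map (stone_cech X) ?K g"
    and ge: "\<And>x. x \<in> topspace X \<Longrightarrow> g (?e x) = (Some \<circ> f) x"
    using stone_cech_extension_exists[OF _ TK] compact_space_Alexandroff_compactification by metis
  show ?thesis
  proof (rule ex1I)
    have "continuous_map (stone_cech X) ?K (restrict g (topspace (stone_cech X)))"
      using g by (rule continuous_map_eq) auto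
    then show "is_stone_cech_extension X f (restrict g (topspace (stone_cech X)))"
      by (auto simp: is_stone_cech_extension_def ge stone_cech_embedding_in_stone_cech)
  next
    fix g' assume g': "is_stone_cech_extension X f g'"
    show "g' = restrict g (topspace (stone_cech X))"
    proof (rule extensionalityI)
      show "g' \<in> extensional (topspace (stone_cech X))"
        using g' by (simp add: is_stone_cech_extension_def)
      fix p assume p: "p \<in> topspace (stone_cech X)"
      then have "p \<in> stone_cech X closure_of (?e ` topspace X)"
        by (simp add: dense_stone_cech_embedding)
      then have "g' p = g p"
        using HK _ g by (rule forall_in_closure_of_eq)
          (use g' ge in \<open>auto simp: is_stone_cech_extension_def\<close>)
      then show "g' p = restrict g (topspace (stone_cech X)) p"
        using p by simp
    qed simp
  qed
qed

lemma is_stone_cech_extension_stone_cech_extension: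
  "continuous_map X euclideanreal f \<Longrightarrow> is_stone_cech_extension X f (stone_cech_extension X f)"
  unfolding stone_cech_extension_def by (rule theI'[OF ex1_stone_cech_extension])

section \<open>Realcompactness\<close>

definition bornological_realcompactification ::
    "'a topology \<Rightarrow> 'a set set \<Rightarrow> (('a \<Rightarrow> real) \<Rightarrow> real) set" where
  "bornological_realcompactification X \<B> =
     {p \<in> topspace (stone_cech X).
        \<forall>f\<in>bounded_continuous_maps X \<B>. stone_cech_extension X f p \<noteq> None}"

text \<open>As usual, \<open>X\<close> is identified with its image in the Stone--Cech compactification.\<close>

definition bornological_realcompact :: "'a topology \<Rightarrow> 'a set set \<Rightarrow> bool" where
  "bornological_realcompact X \<B> \<longleftrightarrow>
     bornological_realcompactification X \<B> = stone_cech_embedding X ` topspace X"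

end

theory Submission
  imports Defs
begin

text \<open>
  Both sides of the equivalence speak about the filters \<open>F\<close> on \<open>X\<close> along which every map in
  \<open>\<C> = \<C>\<^sub>\<B>(X)\<close> converges to a real number.  In the initial uniformity for \<open>\<C>\<close> these are exactly the
  Cauchy filters (\<open>cauchy_initial_uniformity_iff\<close>), so completeness says that for each such \<open>F\<close>
  there is a point \<open>x\<close> of \<open>X\<close> with \<open>f \<longlongrightarrow> f x\<close> along \<open>F\<close> for all \<open>f \<in> \<C>\<close>
  (\<open>le_uniform_nhds_initial_uniformity_iff\<close>).

  In \<open>\<beta>(X)\<close> they are exactly the proper filters that converge to a point of \<open>\<upsilon>\<^sub>\<B>(X)\<close>.  Indeed, a
  filter converges in \<open>\<beta>(X)\<close> if and only if every continuous map from \<open>X\<close> to the unit interval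
  converges along it (\<open>limitin_stone_cech_embedding_iff\<close>); such maps are bounded, hence lie in
  \<open>\<C>\<close>.  If \<open>F\<close> converges to \<open>p\<close>, then by continuity of \<open>f\<^sup>\<beta>\<close> the map \<open>f\<close>
  converges along \<open>F\<close> to \<open>f\<^sup>\<beta>(p)\<close> in the one-point compactification of the reals, and \<open>f\<close> has a
  real limit precisely if that value is not \<open>\<infinity>\<close> (\<open>stone_cech_extension_ne_None_iff\<close>).  By
  density of \<open>X\<close>, every point of \<open>\<upsilon>\<^sub>\<B>(X)\<close> is the limit of such a filter
  (\<open>stone_cech_point_is_limit\<close>).

  Under this correspondence a Cauchy filter has a limit in the uniform space \<open>X\<close> exactly if its
  limit in \<open>\<upsilon>\<^sub>\<B>(X)\<close> belongs to \<open>X\<close>: the values \<open>f x\<close> for \<open>f \<in> \<C>\<close> are then the limits of the maps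
  \<open>f\<close> along the filter, and those of the maps into the unit interval are the coordinates of the
  point in \<open>\<beta>(X)\<close>.  So the space is complete if and only if \<open>\<upsilon>\<^sub>\<B>(X) = X\<close>.
\<close>

section \<open>Cauchy filters and limits in an initial uniformity\<close>

text \<open>
  From left to right, the image of a Cauchy filter under each \<open>f \<in> C\<close> is a Cauchy filter of reals,
  and the reals are complete.  From right to left, a basic entourage constrains only finitely many
  maps, and values of a map within \<open>e / 2\<close> of its limit are within \<open>e\<close> of each other.
\<close>
lemma cauchy_initial_uniformity_iff:
  assumes "F \<le> principal S" "F \<noteq> bot"
  shows "F \<times>\<^sub>F F \<le> initial_uniformity S C \<longleftrightarrow> (\<forall>f\<in>C. \<exists>l. (f \<longlongrightarrow> l) F)"
proof
  assume cauchy: "F \<times>\<^sub>F F \<le> initial_uniformity S C"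
  show "\<forall>f\<in>C. \<exists>l. (f \<longlongrightarrow> l) F"
  proof
    fix f assume "f \<in> C"
    have "\<exists>P. eventually P F \<and> (\<forall>x y. P x \<and> P y \<longrightarrow> dist (f x) (f y) < e)" if "e > 0" for e
    proof -
      have "eventually (\<lambda>(x, y). dist (f x) (f y) < e) (initial_uniformity S C)"
        unfolding eventually_initial_uniformity using \<open>f \<in> C\<close> that
        by (intro exI[of _ "{f}"] exI[of _ e]) (auto simp: dist_real_def)
      then have "eventually (\<lambda>(x, y). dist (f x) (f y) < e) (F \<times>\<^sub>F F)"
        using cauchy by (rule filter_leD[rotated])
      then show ?thesis
        by (auto simp: eventually_prod_same)
    qed
    then have "cauchy_filter (filtermap f F)"
      unfolding cauchy_filter_metric_filtermap by blast
    moreover have "complete (UNIV :: real set)"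
      by (simp add: complete_UNIV)
    ultimately have "\<exists>l. filtermap f F \<le> nhds l"
      using assms(2) by (auto simp: complete_uniform filtermap_bot_iff)
    then show "\<exists>l. (f \<longlongrightarrow> l) F"
      by (simp add: filterlim_def)
  qed
next
  assume "\<forall>f\<in>C. \<exists>l. (f \<longlongrightarrow> l) F"
  then obtain l where l: "\<And>f. f \<in> C \<Longrightarrow> (f \<longlongrightarrow> l f) F"
    by metis
  show "F \<times>\<^sub>F F \<le> initial_uniformity S C"
  proof (rule filter_leI)
    fix E assume "eventually E (initial_uniformity S C)"
    then obtain G e where G: "finite G" "G \<subseteq> C" "e > 0"
      and E: "\<And>x y. x \<in> S \<Longrightarrow> y \<in> S \<Longrightarrow> (\<forall>f\<in>G. \<bar>f x - f y\<bar> < e) \<Longrightarrow> E (x, y)"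
      by (auto simp: eventually_initial_uniformity)
    define P where "P x \<longleftrightarrow> x \<in> S \<and> (\<forall>f\<in>G. dist (f x) (l f) < e / 2)" for x
    have "eventually (\<lambda>x. dist (f x) (l f) < e / 2) F" if "f \<in> G" for f
      using l[of f] that G by (intro tendstoD) auto
    then have "eventually (\<lambda>x. \<forall>f\<in>G. dist (f x) (l f) < e / 2) F"
      using G(1) by (simp add: eventually_ball_finite)
    moreover have "eventually (\<lambda>x. x \<in> S) F"
      using assms(1) by (simp add: le_principal)
    ultimately have "eventually P F"
      unfolding P_def by eventually_elim simp
    moreover have "E (x, y)" if "P x" "P y" for x y
    proof (rule E)
      show "\<forall>f\<in>G. \<bar>f x - f y\<bar> < e"
      proof
        fix f assume "f \<in> G"
        then have "dist (f x) (l f) < e / 2" "dist (f y) (l f) < e / 2"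
          using that by (auto simp: P_def)
        then show "\<bar>f x - f y\<bar> < e"
          unfolding dist_real_def by linarith
      qed
    qed (use that in \<open>auto simp: P_def\<close>)
    ultimately show "eventually E (F \<times>\<^sub>F F)"
      by (auto simp: eventually_prod_same)
  qed
qed

lemma le_uniform_nhds_initial_uniformity_iff:
  assumes "F \<le> principal S" "x \<in> S"
  shows "F \<le> uniform_nhds (initial_uniformity S C) x \<longleftrightarrow> (\<forall>f\<in>C. (f \<longlongrightarrow> f x) F)"
proof
  assume le: "F \<le> uniform_nhds (initial_uniformity S C) x"
  show "\<forall>f\<in>C. (f \<longlongrightarrow> f x) F"
  proof (intro ballI tendstoI)
    fix f and e :: real assume "f \<in> C" "e > 0"
    then have "eventually (\<lambda>y. dist (f y) (f x) < e) (uniform_nhds (initial_uniformity S C) x)"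
      unfolding eventually_uniform_nhds eventually_initial_uniformity
      by (intro exI[of _ "{f}"] exI[of _ e]) (auto simp: dist_real_def)
    then show "eventually (\<lambda>y. dist (f y) (f x) < e) F"
      using le by (rule filter_leD[rotated])
  qed
next
  assume lim: "\<forall>f\<in>C. (f \<longlongrightarrow> f x) F"
  show "F \<le> uniform_nhds (initial_uniformity S C) x"
  proof (rule filter_leI)
    fix P assume "eventually P (uniform_nhds (initial_uniformity S C) x)"
    then obtain G e where G: "finite G" "G \<subseteq> C" "e > 0"
      and P: "\<And>y. y \<in> S \<Longrightarrow> (\<forall>f\<in>G. \<bar>f x - f y\<bar> < e) \<Longrightarrow> P y"
      using assms(2) by (auto simp: eventually_uniform_nhds eventually_initial_uniformity)
    have "eventually (\<lambda>y. dist (f y) (f x) < e) F" if "f \<in> G" for f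
      using lim that G by (intro tendstoD) auto
    then have "eventually (\<lambda>y. \<forall>f\<in>G. dist (f y) (f x) < e) F"
      using G(1) by (simp add: eventually_ball_finite)
    moreover have "eventually (\<lambda>y. y \<in> S) F"
      using assms(1) by (simp add: le_principal)
    ultimately show "eventually P F"
      by eventually_elim (auto intro!: P simp: dist_real_def abs_minus_commute)
  qed
qed

section \<open>Filters converging in the Stone--Cech compactification\<close>

text \<open>
  This inclusion is what lets convergence of the maps in \<open>\<C>\<^sub>\<B>(X)\<close> control convergence in \<open>\<beta>(X)\<close>.
\<close>
lemma cube_index_subset_bounded_continuous_maps:
  "cube_index X \<subseteq> bounded_continuous_maps X \<B>" if "\<B> \<subseteq> Pow (topspace X)"
proof
  fix h assume h: "h \<in> cube_index X"
  then have "continuous_map X euclideanreal h" "h ` topspace X \<subseteq> {0..1}"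
    by (auto simp: cube_index_def continuous_map_in_subtopology)
  moreover have "bounded (h ` B)" if "B \<in> \<B>" for B
    using that \<open>\<B> \<subseteq> _\<close> calculation(2)
    by (intro bounded_subset[OF bounded_closed_interval[of "0::real" 1]]) auto
  ultimately show "h \<in> bounded_continuous_maps X \<B>"
    by (simp add: bounded_continuous_maps_def)
qed

text \<open>
  Limits in the cube are computed coordinatewise, and \<open>\<beta>(X)\<close> and the unit interval are closed, so
  no limit escapes from them.  Hence the family of the limits along \<open>F\<close> of all maps into the unit
  interval, if they exist, already is a point of \<open>\<beta>(X)\<close>.
\<close>
lemma limitin_stone_cech_embedding_iff:
  assumes "F \<le> principal (topspace X)" "F \<noteq> bot"
  shows "limitin (stone_cech X) (stone_cech_embedding X) p F \<longleftrightarrow>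
     p \<in> extensional (cube_index X) \<and> (\<forall>h\<in>cube_index X. (h \<longlongrightarrow> p h) F)"
proof -
  let ?e = "stone_cech_embedding X"
  have S: "eventually (\<lambda>x. x \<in> topspace X) F"
    using assms(1) by (simp add: le_principal)
  have inZ: "eventually (\<lambda>x. ?e x \<in> topspace (stone_cech X)) F"
    using S by eventually_elim (rule stone_cech_embedding_in_stone_cech)
  have inC: "eventually (\<lambda>x. ?e x \<in> topspace (cube X)) F"
    using S by eventually_elim (rule stone_cech_embedding_in_cube)
  have closed: "closedin (cube X) (topspace (stone_cech X))"
    by (simp add: topspace_stone_cech)
  have coordinate: "limitin (top_of_set {0..1}) (\<lambda>x. ?e x h) (p h) F \<longleftrightarrow> (h \<longlongrightarrow> p h) F"
    if h: "h \<in> cube_index X" for h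
  proof -
    have e: "(\<lambda>x. ?e x h) = h"
      using h by (simp add: stone_cech_embedding_def)
    have "eventually (\<lambda>x. h x \<in> {0..1}) F"
      using S by eventually_elim
        (use h in \<open>auto simp: cube_index_def continuous_map_in_subtopology\<close>)
    moreover from this have "p h \<in> {0..1}" if "(h \<longlongrightarrow> p h) F"
      using that assms(2) by (intro Lim_in_closed_set[of "{0..1}" h F]) auto
    ultimately show ?thesis
      unfolding e by (auto simp: limitin_subtopology)
  qed
  have "limitin (stone_cech X) ?e p F \<longleftrightarrow> limitin (cube X) ?e p F"
  proof
    assume "limitin (stone_cech X) ?e p F"
    then show "limitin (cube X) ?e p F"
      by (simp add: stone_cech_def limitin_subtopology)
  next
    assume lim: "limitin (cube X) ?e p F"
    have "p \<in> topspace (stone_cech X)"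
      using lim closed inZ assms(2) by (rule limitin_closedin)
    then show "limitin (stone_cech X) ?e p F"
      using lim inZ unfolding topspace_stone_cech
      by (simp add: stone_cech_def limitin_subtopology)
  qed
  also have "\<dots> \<longleftrightarrow> p \<in> extensional (cube_index X) \<and>
      (\<forall>h\<in>cube_index X. limitin (top_of_set {0..1}) (\<lambda>x. ?e x h) (p h) F)"
    using inC unfolding cube_def limitin_componentwise by simp
  also have "\<dots> \<longleftrightarrow> p \<in> extensional (cube_index X) \<and> (\<forall>h\<in>cube_index X. (h \<longlongrightarrow> p h) F)"
    by (simp add: coordinate)
  finally show ?thesis .
qed

text \<open>
  The filter is the trace on \<open>X\<close> of the neighbourhood filter of \<open>p\<close>; it is proper because \<open>X\<close> is
  dense in \<open>\<beta>(X)\<close>.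
\<close>
lemma stone_cech_point_is_limit:
  assumes "p \<in> topspace (stone_cech X)"
  obtains F where "F \<le> principal (topspace X)" "F \<noteq> bot"
    "limitin (stone_cech X) (stone_cech_embedding X) p F"
proof
  let ?e = "stone_cech_embedding X"
  let ?N = "filtercomap ?e (nhdsin (stone_cech X) p)"
  let ?F = "inf ?N (principal (topspace X))"
  have ev: "eventually (\<lambda>x. ?e x \<in> U) ?F" if "openin (stone_cech X) U" "p \<in> U" for U
  proof -
    have "eventually (\<lambda>q. q \<in> U) (nhdsin (stone_cech X) p)"
      using that assms by (auto simp: eventually_nhdsin)
    then have "eventually (\<lambda>x. ?e x \<in> U) ?N"
      by (rule eventually_filtercomapI)
    then show ?thesis
      by (rule filter_leD[rotated]) simp
  qed
  show "?F \<le> principal (topspace X)"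
    by simp
  show "limitin (stone_cech X) ?e p ?F"
    using assms ev by (auto simp: limitin_def)
  show "?F \<noteq> bot"
  proof
    assume "?F = bot"
    then have "eventually (\<lambda>x. False) ?F"
      by simp
    then have "eventually (\<lambda>x. x \<notin> topspace X) ?N"
      by (simp add: eventually_inf_principal)
    then obtain U where U: "openin (stone_cech X) U" "p \<in> U"
      and "\<And>x. ?e x \<in> U \<Longrightarrow> x \<notin> topspace X"
      using assms by (auto simp: eventually_filtercomap eventually_nhdsin)
    moreover have "p \<in> stone_cech X closure_of (?e ` topspace X)"
      using assms by (simp add: dense_stone_cech_embedding)
    ultimately show False
      by (auto simp: in_closure_of)
  qed
qed

section \<open>Values of the extension to the Stone--Cech compactification\<close>

text \<open>
  The embedding of a space into its one-point compactification is continuous and open, so it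
  preserves and reflects limits at points other than infinity.
\<close>
lemma limitin_Alexandroff_compactification_Some_iff:
  "limitin (Alexandroff_compactification X) (\<lambda>x. Some (f x)) (Some r) F \<longleftrightarrow> limitin X f r F"
proof
  assume lim: "limitin (Alexandroff_compactification X) (\<lambda>x. Some (f x)) (Some r) F"
  show "limitin X f r F"
    unfolding limitin_def
  proof (intro conjI allI impI)
    show "r \<in> topspace X"
      using limitin_topspace[OF lim] by auto
    fix U assume "openin X U \<and> r \<in> U"
    then have "eventually (\<lambda>x. Some (f x) \<in> Some ` U) F"
      using lim unfolding limitin_def
      by (auto simp: openin_Alexandroff_compactification)
    then show "eventually (\<lambda>x. f x \<in> U) F"
      by eventually_elim auto
  qed
next
  assume "limitin X f r F"
  then show "limitin (Alexandroff_compactification X) (\<lambda>x. Some (f x)) (Some r) F"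
    using continuous_map_limit[OF continuous_map_Some] by (simp add: o_def)
qed

lemma limitin_stone_cech_extension:
  assumes f: "continuous_map X euclideanreal f" and F: "F \<le> principal (topspace X)"
    and lim: "limitin (stone_cech X) (stone_cech_embedding X) p F"
  shows "limitin (Alexandroff_compactification euclideanreal) (\<lambda>x. Some (f x))
           (stone_cech_extension X f p) F"
proof -
  have ext: "is_stone_cech_extension X f (stone_cech_extension X f)"
    using f by (rule is_stone_cech_extension_stone_cech_extension)
  have "limitin (Alexandroff_compactification euclideanreal)
      (stone_cech_extension X f \<circ> stone_cech_embedding X) (stone_cech_extension X f p) F"
    using ext lim by (auto simp: is_stone_cech_extension_def intro: continuous_map_limit)
  moreover have "eventually (\<lambda>x. x \<in> topspace X) F"
    using F by (simp add: le_principal)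
  then have "eventually (\<lambda>x. (stone_cech_extension X f \<circ> stone_cech_embedding X) x = Some (f x)) F"
    by eventually_elim (use ext in \<open>auto simp: is_stone_cech_extension_def\<close>)
  ultimately show ?thesis
    by (rule limitin_transform_eventually[rotated])
qed

text \<open>
  The map \<open>f\<close> tends to \<open>f\<^sup>\<beta>(p)\<close> along \<open>F\<close> in the one-point compactification, which is Hausdorff: a
  real limit of \<open>f\<close> along \<open>F\<close> therefore has to agree with \<open>f\<^sup>\<beta>(p)\<close>.
\<close>
lemma stone_cech_extension_ne_None_iff:
  assumes f: "continuous_map X euclideanreal f"
    and F: "F \<le> principal (topspace X)" "F \<noteq> bot"
    and lim: "limitin (stone_cech X) (stone_cech_embedding X) p F"
  shows "stone_cech_extension X f p \<noteq> None \<longleftrightarrow> (\<exists>l. (f \<longlongrightarrow> l) F)"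
proof
  note limf = limitin_stone_cech_extension[OF f F(1) lim]
  show "\<exists>l. (f \<longlongrightarrow> l) F" if "stone_cech_extension X f p \<noteq> None"
    using that limf by (auto simp: limitin_Alexandroff_compactification_Some_iff)
  show "stone_cech_extension X f p \<noteq> None" if conv: "\<exists>l. (f \<longlongrightarrow> l) F"
  proof -
    obtain l where "(f \<longlongrightarrow> l) F"
      using conv by blast
    then have "limitin (Alexandroff_compactification euclideanreal) (\<lambda>x. Some (f x)) (Some l) F"
      by (simp add: limitin_Alexandroff_compactification_Some_iff)
    moreover have "Hausdorff_space (Alexandroff_compactification euclideanreal)"
      by (simp add: Hausdorff_space_Alexandroff_compactification locally_compact_space_euclidean)
    ultimately have "stone_cech_extension X f p = Some l"
      using limf F(2) by (metis limitin_Hausdorff_unique)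
    then show ?thesis by simp
  qed
qed

section \<open>Realcompactness and completeness\<close>

theorem corollary16:
  fixes X :: "'a topology" and \<B> :: "'a set set"
  assumes "bornological_universe X \<B>" and "Tychonoff_space X"
  shows "bornological_realcompact X \<B> \<longleftrightarrow>
         complete_uniform_space (topspace X)
           (initial_uniformity (topspace X) (bounded_continuous_maps X \<B>))"
proof -
  let ?e = "stone_cech_embedding X" and ?C = "bounded_continuous_maps X \<B>"
  have cont: "continuous_map X euclideanreal f" if "f \<in> ?C" for f
    using that by (simp add: bounded_continuous_maps_def)
  have idx: "h \<in> ?C" if "h \<in> cube_index X" for h
    using cube_index_subset_bounded_continuous_maps[of \<B> X] assms(1) that
    by (auto simp: bornological_universe_def bornology_on_def)
  have ext_e: "stone_cech_extension X f (?e x) = Some (f x)"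
    if "f \<in> ?C" "x \<in> topspace X" for f x
    using is_stone_cech_extension_stone_cech_extension[OF cont[OF that(1)]] that(2)
    by (simp add: is_stone_cech_extension_def)
  have "?e ` topspace X \<subseteq> bornological_realcompactification X \<B>"
    by (auto simp: bornological_realcompactification_def ext_e stone_cech_embedding_in_stone_cech)
  then have "bornological_realcompact X \<B> \<longleftrightarrow>
      bornological_realcompactification X \<B> \<subseteq> ?e ` topspace X"
    unfolding bornological_realcompact_def by blast
  also have "\<dots> \<longleftrightarrow> complete_uniform_space (topspace X) (initial_uniformity (topspace X) ?C)"
  proof
    assume rc: "bornological_realcompactification X \<B> \<subseteq> ?e ` topspace X"
    show "complete_uniform_space (topspace X) (initial_uniformity (topspace X) ?C)"
      unfolding complete_uniform_space_def
    proof (intro allI impI)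
      fix F assume F: "F \<le> principal (topspace X)" "F \<noteq> bot"
        and "F \<times>\<^sub>F F \<le> initial_uniformity (topspace X) ?C"
      then have conv: "\<forall>f\<in>?C. \<exists>l. (f \<longlongrightarrow> l) F"
        by (simp add: cauchy_initial_uniformity_iff)
      \<comment> \<open>the limits of the maps to the unit interval are the coordinates of the limit in \<open>\<beta>(X)\<close>\<close>
      define p where "p = (\<lambda>h\<in>cube_index X. Lim F h)"
      have "(h \<longlongrightarrow> p h) F" if h: "h \<in> cube_index X" for h
      proof -
        obtain l where "(h \<longlongrightarrow> l) F"
          using conv idx[OF h] by blast
        with h show ?thesis
          using tendsto_Lim[OF F(2)] by (auto simp: p_def)
      qed
      then have lim: "limitin (stone_cech X) ?e p F"
        by (simp add: limitin_stone_cech_embedding_iff[OF F] p_def)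
      have "p \<in> bornological_realcompactification X \<B>"
        unfolding bornological_realcompactification_def
        using conv stone_cech_extension_ne_None_iff[OF cont F lim] limitin_topspace[OF lim]
        by auto
      then obtain x where x: "x \<in> topspace X" "p = ?e x"
        using rc by auto
      have "(f \<longlongrightarrow> f x) F" if "f \<in> ?C" for f
        using limitin_stone_cech_extension[OF cont[OF that] F(1) lim]
        by (simp add: x ext_e that limitin_Alexandroff_compactification_Some_iff)
      then show "\<exists>x\<in>topspace X. F \<le> uniform_nhds (initial_uniformity (topspace X) ?C) x"
        using x(1) le_uniform_nhds_initial_uniformity_iff[OF F(1)] by blast
    qed
  next
    assume complete: "complete_uniform_space (topspace X) (initial_uniformity (topspace X) ?C)"
    show "bornological_realcompactification X \<B> \<subseteq> ?e ` topspace X"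
    proof
      fix p assume p: "p \<in> bornological_realcompactification X \<B>"
      then obtain F where F: "F \<le> principal (topspace X)" "F \<noteq> bot"
        and lim: "limitin (stone_cech X) ?e p F"
        using stone_cech_point_is_limit[of p X]
        by (auto simp: bornological_realcompactification_def)
      have "\<forall>f\<in>?C. \<exists>l. (f \<longlongrightarrow> l) F"
        using p stone_cech_extension_ne_None_iff[OF cont F lim]
        by (auto simp: bornological_realcompactification_def)
      then obtain x where x: "x \<in> topspace X"
        and "F \<le> uniform_nhds (initial_uniformity (topspace X) ?C) x"
        using complete F by (auto simp: complete_uniform_space_def cauchy_initial_uniformity_iff)
      then have "\<forall>f\<in>?C. (f \<longlongrightarrow> f x) F"
        by (simp add: le_uniform_nhds_initial_uniformity_iff[OF F(1)])
      then have "limitin (stone_cech X) ?e (?e x) F"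
        by (auto simp: limitin_stone_cech_embedding_iff[OF F] stone_cech_embedding_def idx)
      then have "p = ?e x"
        using lim F(2) Hausdorff_space_stone_cech by (metis limitin_Hausdorff_unique)
      then show "p \<in> ?e ` topspace X"
        using x by simp
    qed
  qed
  finally show ?thesis .
qed

end
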